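(* Let $\mathbb{F}_q$ be a finite field with $q$ elements, let $n>1$ be an integer, let $1\le k_1<\cdots<k_r\le n$ be integers with $1\le r\le n-1$, and let $S=\bigsqcup_{i=1}^r V_{k_i}\subset M_n(\mathbb{F}_q)$. Then the gcd-graph $\Gamma(M_n(\mathbb{F}_q),S)$ is Hamiltonian.
   Context: For $1\le k\le n$, $V_k$ denotes the set of all matrices of rank $k$ in the ring $M_n(\mathbb{F}_q)$ of $n\times n$ matrices over $\mathbb{F}_q$. $\Gamma(M_n(\mathbb{F}_q),S)$ denotes the graph with vertex set $M_n(\mathbb{F}_q)$ in which two vertices $X,Y$ are adjacent if $X-Y\in S$. It is called a gcd-graph when $GL_n(\mathbb{F}_q)\,S\,GL_n(\mathbb{F}_q)=S$; the gcd-graphs over $M_n(\mathbb{F}_q)$ are those with $S$ a union of sets $V_k$, $1\le k\le n$, and the assumption $1\le r\le n-1$ excludes the empty and complete graphs. A graph is Hamiltonian if it contains a cycle visiting every vertex exactly once before returning to its starting vertex. *)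

theory Defs
  imports "HOL-Analysis.Analysis" "Graph_Theory.Arc_Walk"
begin

text \<open>
  The field with q elements is a type of sort field and finite, the ring of n by n matrices over it
  is the type \<^typ>\<open>'a^'n^'n\<close> with n being the cardinality of the index type.
  \<^const>\<open>rank\<close> is the library rank over an arbitrary field.
\<close>

definition rank_matrices :: "nat \<Rightarrow> ('a::field^'n^'n) set" where
  "rank_matrices k = {A. rank A = k}"

text \<open>
  An undirected edge is represented by its two orientations, as is usual for this graph library.
  The digraph is symmetric and loop-free if S is closed under negation and does not contain 0,
  in particular if S is a union of sets of matrices of fixed positive rank.
\<close>

definition matrix_graph ::
    "('a::field^'n^'n) set \<Rightarrow> ('a^'n^'n, ('a^'n^'n) \<times> ('a^'n^'n)) pre_digraph" where
  "matrix_graph S = \<lparr>verts = UNIV, arcs = {(X, Y). X - Y \<in> S}, tail = fst, head = snd\<rparr>"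

text \<open>
  \<^const>\<open>pre_digraph.cycle\<close> is a nonempty closed walk whose vertices are distinct except that
  the first one is repeated at the end. It admits the closed walk u, v, u along a single undirected
  edge, hence the bound on the length. The heads of the arcs of a closed walk are all of its vertices.
\<close>

definition hamiltonian :: "('a, 'b) pre_digraph \<Rightarrow> bool" where
  "hamiltonian G \<longleftrightarrow>
     (\<exists>p. pre_digraph.cycle G p \<and> 3 \<le> length p \<and> head G ` set p = verts G)"

end

theory Submission
  imports Defs "HOL-Number_Theory.Cong"
begin

text \<open>
  The set S contains all matrices of some rank k between 1 and n. These generate the additive group
  of matrices: each multiple of a matrix unit is a difference of two matrices of rank k. So it
  suffices to find a Hamiltonian cycle in a Cayley graph of an elementary abelian p-group with a
  generating set T. Starting from the zero subgroup, suppose that xs enumerates a subgroup H along a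
  path that starts at 0, and let t be an element of T outside H. With d = last xs - t, the translates
  of xs by 0, d, ..., (p - 1) d lie in the distinct cosets of H in the subgroup generated by H and t,
  and the step from the end of one translate to the beginning of the next one is t. The resulting
  path ends at p (last xs) - (p - 1) t = t, so it always closes up to a cycle.
\<close>

subsection \<open>Cycles from lists of vertices\<close>

text \<open>Arcs are pairs of vertices, so pairing a list with its own shift gives the walk along
  it. The end \<open>v\<close> is independent of \<open>hd xs\<close> so that the induction can drop
  the head.\<close>

lemma cas_zip_arcs:
  assumes "tail G = fst" "head G = snd" "xs \<noteq> []"
  shows "pre_digraph.cas G (hd xs) (zip xs (tl xs @ [v])) v"
    and "pre_digraph.awalk_verts G (hd xs) (zip xs (tl xs @ [v])) = xs @ [v]"
  using assms(3)
proof (induction xs)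
  case (Cons x xs)
  {
    case 1
    show ?case using Cons assms(1,2)
      by (cases xs) (auto simp: pre_digraph.cas.simps)
  next
    case 2
    show ?case using Cons assms(1,2)
      by (cases xs) (auto simp: pre_digraph.awalk_verts.simps)
  }
qed simp_all

lemma set_zip_tl_subset:
  assumes "successively (\<lambda>x y. (x, y) \<in> A) xs" "xs \<noteq> []" "(last xs, v) \<in> A"
  shows "set (zip xs (tl xs @ [v])) \<subseteq> A"
  using assms
proof (induction xs)
  case (Cons x xs)
  then show ?case by (cases xs) auto
qed simp

lemma hamiltonian_matrix_graphI:
  fixes S :: "('a::field^'n^'n) set"
  assumes "distinct xs" "set xs = UNIV" "3 \<le> length xs"
    and "successively (\<lambda>x y. x - y \<in> S) xs" "last xs - hd xs \<in> S"
  shows "hamiltonian (matrix_graph S)"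
proof -
  define G where "G = matrix_graph S"
  define p where "p = zip xs (tl xs @ [hd xs])"
  have G: "tail G = fst" "head G = snd" "verts G = UNIV" "arcs G = {(X, Y). X - Y \<in> S}"
    by (simp_all add: G_def matrix_graph_def)
  have ne: "xs \<noteq> []" using assms(3) by auto
  have len: "length (tl xs @ [hd xs]) = length xs" using ne by (cases xs) auto
  have "set p \<subseteq> arcs G"
    unfolding p_def by (rule set_zip_tl_subset) (use assms ne in \<open>auto simp: G\<close>)
  then have "pre_digraph.awalk G (hd xs) p (hd xs)"
    using cas_zip_arcs(1)[OF G(1,2) ne, of "hd xs"] by (simp add: pre_digraph.awalk_def G(3) p_def)
  moreover have "distinct (tl (pre_digraph.awalk_verts G (hd xs) p))"
    unfolding p_def cas_zip_arcs(2)[OF G(1,2) ne] using assms(1) ne by (cases xs) auto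
  moreover have "p \<noteq> []" using ne len by (auto simp: p_def)
  ultimately have "pre_digraph.cycle G p" by (auto simp: pre_digraph.cycle_def)
  moreover have "head G ` set p = verts G"
  proof -
    have "head G ` set p = set (map snd p)" by (simp add: G)
    also have "map snd p = tl xs @ [hd xs]" using len by (simp add: p_def)
    also have "set \<dots> = set xs" using ne by (cases xs) auto
    finally show ?thesis using assms(2) G by simp
  qed
  moreover have "3 \<le> length p" using assms(3) len by (simp add: p_def)
  ultimately show ?thesis unfolding hamiltonian_def G_def by blast
qed

subsection \<open>Cayley graphs of elementary abelian groups\<close>

definition additive_subgroup :: "'g::ab_group_add set \<Rightarrow> bool" where
  "additive_subgroup H \<longleftrightarrow> 0 \<in> H \<and> (\<forall>x\<in>H. \<forall>y\<in>H. x - y \<in> H)"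

lemma additive_subgroupD:
  assumes "additive_subgroup H"
  shows "0 \<in> H" "x \<in> H \<Longrightarrow> y \<in> H \<Longrightarrow> x - y \<in> H" "x \<in> H \<Longrightarrow> y \<in> H \<Longrightarrow> x + y \<in> H"
proof -
  show 0: "0 \<in> H" using assms by (simp add: additive_subgroup_def)
  show d: "x - y \<in> H" if "x \<in> H" "y \<in> H" for x y
    using assms that by (simp add: additive_subgroup_def)
  show "x \<in> H \<Longrightarrow> y \<in> H \<Longrightarrow> x + y \<in> H" using d[OF _ d[OF 0], of x y] by simp
qed

lemma additive_subgroup_sum:
  assumes "additive_subgroup H" "\<And>i. i \<in> A \<Longrightarrow> f i \<in> H"
  shows "sum f A \<in> H"
  using assms(2) by (induction A rule: infinite_finite_induct) (auto intro: additive_subgroupD[OF assms(1)])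

lemma additive_subgroup_of_nat_mult:
  fixes x :: "'g::ring_1"
  assumes "additive_subgroup H" "x \<in> H"
  shows "of_nat m * x \<in> H"
  by (induction m) (auto simp: algebra_simps intro: additive_subgroupD[OF assms(1)] assms(2))

text \<open>Each step subtracts an element of \<open>T\<close>, in the direction of the arcs of the
  graph. Starting at 0 turns the closing condition into \<open>last xs \<in> T\<close>.\<close>

definition cayley_path :: "'g::ab_group_add set \<Rightarrow> 'g list \<Rightarrow> bool" where
  "cayley_path T xs \<longleftrightarrow> xs \<noteq> [] \<and> hd xs = 0 \<and> successively (\<lambda>x y. x - y \<in> T) xs"

text \<open>One translate ends at \<open>last xs + of_nat i * d\<close> and the next starts at
  \<open>of_nat (Suc i) * d\<close>, so the step between them is \<open>last xs - d = t\<close>. The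
  end vertex is carried along for the induction.\<close>

lemma cayley_path_translates:
  fixes T :: "'g::ring_1 set"
  assumes "cayley_path T xs" "t \<in> T"
  defines "d \<equiv> last xs - t"
  defines "translate \<equiv> \<lambda>i. map (\<lambda>x. x + of_nat i * d) xs"
  shows "cayley_path T (concat (map translate [0..<Suc m])) \<and>
    last (concat (map translate [0..<Suc m])) = last xs + of_nat m * d"
proof (induction m)
  case 0
  show ?case using assms(1) by (simp add: translate_def)
next
  case (Suc m)
  have xs: "xs \<noteq> []" "hd xs = 0" "successively (\<lambda>x y. x - y \<in> T) xs"
    using assms(1) by (auto simp: cayley_path_def)
  let ?ys = "concat (map translate [0..<Suc m])"
  have eq: "concat (map translate [0..<Suc (Suc m)]) = ?ys @ translate (Suc m)" by simp
  have row: "translate (Suc m) \<noteq> []" "hd (translate (Suc m)) = of_nat (Suc m) * d"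
    "last (translate (Suc m)) = last xs + of_nat (Suc m) * d"
    using xs by (simp_all add: translate_def hd_map last_map)
  have "successively (\<lambda>x y. x - y \<in> T) (translate (Suc m))"
    using xs(3) by (simp add: translate_def successively_map)
  moreover have "last ?ys - hd (translate (Suc m)) \<in> T"
    using Suc assms(2) unfolding row(2) by (simp add: algebra_simps d_def)
  ultimately show ?case
    using Suc row unfolding eq cayley_path_def successively_append_iff
    by (simp add: hd_append2 del: upt_Suc concat_append map_append)
qed

text \<open>Modulo \<open>H\<close> the element \<open>d\<close> has order exactly \<open>p\<close>,
  so the \<open>p\<close> translates of \<open>H\<close> are disjoint and fill the subgroup
  generated by \<open>H\<close> and \<open>t\<close>.\<close>

lemma cayley_path_extend:
  fixes T :: "'g::ring_1 set" and p :: nat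
  assumes p: "prime p" "of_nat p = (0::'g)"
    and H: "additive_subgroup H"
    and xs: "cayley_path T xs" "distinct xs" "set xs = H"
    and t: "t \<in> T" "t \<notin> H"
  obtains ys where "cayley_path T ys" "distinct ys" "additive_subgroup (set ys)"
    "H \<subseteq> set ys" "t \<in> set ys" "last ys = t"
proof -
  define d where "d = last xs - t"
  define translate where "translate = (\<lambda>i. map (\<lambda>x. x + of_nat i * d) xs)"
  define ys where "ys = concat (map translate [0..<p])"
  have xs_ne: "xs \<noteq> []" using xs(1) by (simp add: cayley_path_def)
  have lastH: "last xs \<in> H" using xs_ne xs(3) by auto
  have d_notin: "d \<notin> H"
    using additive_subgroupD(2)[OF H lastH, of d] t(2) by (auto simp: d_def)
  obtain m where m: "p = Suc m" using prime_gt_0_nat[OF p(1)] by (cases p) auto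
  \<comment> \<open>Hence the last translate ends at \<open>last xs - d = t\<close>.\<close>
  have of_nat_m: "of_nat m = (-1 :: 'g)"
    using p(2) unfolding m by (simp add: eq_neg_iff_add_eq_0 add.commute)
  have path: "cayley_path T ys" and last_ys: "last ys = t"
    using cayley_path_translates[OF xs(1) t(1), of m]
    unfolding ys_def m translate_def d_def by (simp_all add: of_nat_m del: upt_Suc)
  have of_nat_mod: "of_nat (i mod p) = (of_nat i :: 'g)" for i
  proof -
    have "(of_nat i :: 'g) = of_nat (i div p * p + i mod p)" by simp
    also have "\<dots> = of_nat (i mod p)" unfolding of_nat_add of_nat_mult p(2) by simp
    finally show ?thesis by simp
  qed
  have disj: "i = j" if "i < p" "j < p" "x \<in> H" "y \<in> H" "x + of_nat i * d = y + of_nat j * d" for i j x y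
  proof -
    have "\<not> i < j" if ij: "i < j" "j < p" "x \<in> H" "y \<in> H" "x + of_nat i * d = y + of_nat j * d" for i j x y
    proof -
      have "\<not> p dvd (j - i)" using ij by (auto dest: dvd_imp_le)
      then have "coprime (j - i) p" using p(1) by (simp add: prime_imp_coprime coprime_commute)
      \<comment> \<open>If two translates met, \<open>H\<close> would contain
        \<open>of_nat (j - i) * d\<close>; multiplying by the inverse \<open>u\<close> modulo
        \<open>p\<close> would put \<open>d\<close> itself into \<open>H\<close>.\<close>
      then obtain u where u: "[(j - i) * u = Suc 0] (mod p)" using cong_solve_coprime_nat by blast
      have "of_nat (j - i) * d = x - y" using ij by (simp add: of_nat_diff algebra_simps)
      then have "of_nat u * (of_nat (j - i) * d) \<in> H"
        using ij H by (auto intro!: additive_subgroup_of_nat_mult additive_subgroupD(2))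
      moreover have "of_nat u * (of_nat (j - i) * d) = of_nat ((u * (j - i)) mod p) * d"
        unfolding of_nat_mod by (simp only: of_nat_mult mult.assoc)
      moreover have "(u * (j - i)) mod p = 1"
        using u prime_gt_1_nat[OF p(1)] by (simp add: cong_def mult.commute)
      ultimately show ?thesis using d_notin by simp
    qed
    from this[of i j x y] this[of j i y x] that show ?thesis by (metis linorder_neqE_nat)
  qed
  have dist_translate: "distinct (translate i)" for i
    using xs(2) by (simp add: translate_def distinct_map inj_on_def)
  have translate_set: "set (translate i) = {x + of_nat i * d |x. x \<in> H}" for i
    using xs(3) by (auto simp: translate_def)
  have dist: "distinct (concat (map translate [0..<k]))" if "k \<le> p" for k
    using that
  proof (induction k)
    case (Suc k)
    have "x \<notin> set (translate k)" if "i < k" "x \<in> set (translate i)" for i x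
      using disj[of i k] that Suc.prems by (auto simp: translate_set)
    then show ?case using Suc dist_translate by auto
  qed simp
  \<comment> \<open>Here \<open>i\<close> runs over all naturals, by reduction modulo
    \<open>p\<close>, so the closure argument has no range to respect.\<close>
  have set_ys: "set ys = {x + of_nat i * d |x i. x \<in> H}"
  proof -
    have "x + of_nat i * d \<in> set ys" if "x \<in> H" for x i
    proof -
      have "i mod p < p" using prime_gt_0_nat[OF p(1)] by simp
      moreover have "x + of_nat i * d \<in> set (translate (i mod p))"
        using that by (auto simp: translate_set of_nat_mod)
      ultimately show ?thesis by (auto simp: ys_def)
    qed
    then show ?thesis by (auto simp: ys_def translate_set)
  qed
  have "additive_subgroup (set ys)"
    unfolding additive_subgroup_def
  proof (intro conjI ballI)
    have "0 + of_nat 0 * d \<in> set ys" unfolding set_ys using additive_subgroupD(1)[OF H] by blast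
    then show "0 \<in> set ys" by simp
    fix v w assume "v \<in> set ys" "w \<in> set ys"
    then obtain x i y j where "x \<in> H" "y \<in> H" "v = x + of_nat i * d" "w = y + of_nat j * d"
      unfolding set_ys by blast
    \<comment> \<open>Since \<open>m\<close> is -1 in the ring, the natural multiple by
      \<open>m * j\<close> expresses the negative one.\<close>
    moreover have "x + of_nat i * d - (y + of_nat j * d) = (x - y) + of_nat (i + m * j) * d"
      by (simp add: of_nat_m algebra_simps)
    ultimately show "v - w \<in> set ys"
      unfolding set_ys using additive_subgroupD(2)[OF H] by blast
  qed
  moreover have "H \<subseteq> set ys"
  proof
    fix x assume "x \<in> H"
    then have "x + of_nat 0 * d \<in> set ys" unfolding set_ys by blast
    then show "x \<in> set ys" by simp
  qed
  moreover have "t \<in> set ys"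
    using path last_ys by (auto simp: cayley_path_def)
  ultimately show thesis using that path dist[of p] last_ys by (auto simp: ys_def)
qed

text \<open>
  The ring structure only serves to express that the additive group has exponent p. On matrices it
  is the componentwise one.
\<close>

theorem cayley_hamiltonian_cycle:
  fixes T :: "'g::{ring_1,finite} set" and p :: nat
  assumes p: "prime p" "of_nat p = (0::'g)"
    and gen: "\<And>H. additive_subgroup H \<Longrightarrow> T \<subseteq> H \<Longrightarrow> H = UNIV"
  obtains xs where "distinct xs" "set xs = UNIV" "successively (\<lambda>x y. x - y \<in> T) xs"
    "last xs - hd xs \<in> T"
proof -
  \<comment> \<open>A longest good list will be the cycle. The start \<open>[0]\<close> is exempt
    from the closing condition, as 0 may lie outside \<open>T\<close>.\<close>
  define good where "good = (\<lambda>xs :: 'g list. cayley_path T xs \<and> distinct xs \<and>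
    additive_subgroup (set xs) \<and> (xs = [0] \<or> last xs \<in> T))"
  have "good [0]" by (simp add: good_def cayley_path_def additive_subgroup_def)
  moreover have "length ys < Suc (CARD('g))" if "good ys" for ys
    using that card_mono[of UNIV "set ys"] by (simp add: good_def distinct_card)
  ultimately obtain xs where xs: "good xs" and max: "\<And>ys. good ys \<Longrightarrow> length ys \<le> length xs"
    using ex_has_greatest_nat[of good "[0]" length] by metis
  have xs': "cayley_path T xs" "distinct xs" "additive_subgroup (set xs)" "xs = [0] \<or> last xs \<in> T"
    using xs by (auto simp: good_def)
  have "T \<subseteq> set xs"
  proof
    fix t assume "t \<in> T"
    show "t \<in> set xs"
    proof (rule ccontr)
      assume t: "t \<notin> set xs"
      obtain ys where ys: "cayley_path T ys" "distinct ys" "additive_subgroup (set ys)"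
          "set xs \<subseteq> set ys" "t \<in> set ys" "last ys = t"
        using cayley_path_extend[OF p xs'(3,1,2) refl \<open>t \<in> T\<close> t] by blast
      have "good ys" using ys \<open>t \<in> T\<close> by (simp add: good_def)
      \<comment> \<open>By maximality the extension gains no vertex, although it contains the new
        element \<open>t\<close>.\<close>
      then have "card (set ys) \<le> card (set xs)"
        using max xs'(2) ys(2) by (simp add: distinct_card)
      then have "set xs = set ys" using ys(4) by (intro card_seteq) auto
      then show False using t ys(5) by simp
    qed
  qed
  then have univ: "set xs = UNIV" using gen xs'(3) by blast
  then have "xs \<noteq> [0]" by (metis UNIV_I empty_iff empty_set set_ConsD zero_neq_one)
  then have "last xs - hd xs \<in> T" using xs' by (simp add: cayley_path_def)
  then show thesis using that xs' univ by (simp add: cayley_path_def)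
qed

subsection \<open>Generation by the matrices of a fixed rank\<close>

text \<open>The two inclusions make the row space the coordinate subspace on \<open>J\<close>, which
  has the unit vectors indexed by \<open>J\<close> as a basis.\<close>

lemma rank_eq_card_of_rows:
  fixes A :: "'a::field^'n^'m"
  assumes "rows A \<subseteq> vec.span ((\<lambda>j. axis j 1) ` J)" "(\<lambda>j. axis j 1) ` J \<subseteq> vec.span (rows A)"
  shows "rank A = card J"
proof -
  let ?B = "(\<lambda>j. axis j 1 :: 'a^'n) ` J"
  have "vec.independent ?B"
    by (rule vec.independent_mono[OF independent_cart_basis]) (auto simp: cart_basis_def)
  moreover have "vec.span ?B = vec.span (rows A)"
    using assms by (simp add: vec.span_eq)
  ultimately have "vec.dim (rows A) = card ?B"
    by (intro vec.dim_eq_card)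
  moreover have "card ?B = card J"
    by (rule card_image) (auto simp: inj_on_def axis_eq_axis)
  ultimately show ?thesis by (simp add: row_rank_def_gen)
qed

text \<open>A partial permutation matrix gets \<open>c\<close> times row \<open>i\<close> added to
  row \<open>a\<close>. Row \<open>i\<close> itself is intact because \<open>i \<noteq> a\<close>,
  so the addition can be undone and the row space is the same for every \<open>c\<close>.\<close>

lemma rank_partial_permutation_transvection:
  fixes c :: "'a::field" and f :: "'n::finite \<Rightarrow> 'n" and a i :: 'n
  assumes "inj f" "i \<in> K" "i \<noteq> a"
  shows "rank ((\<chi> r. (if r \<in> K then axis (f r) 1 else 0) + (if r = a then axis (f i) c else 0)) :: 'a^'n^'n)
    = card K"
proof -
  define A :: "'a^'n^'n"
    where "A = (\<chi> r. (if r \<in> K then axis (f r) 1 else 0) + (if r = a then axis (f i) c else 0))"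
  have row: "row r A = (if r \<in> K then axis (f r) 1 else 0) + (if r = a then axis (f i) c else 0)" for r
    by (simp add: row_def A_def vec_eq_iff)
  have axis_c: "axis (f i) c = c *s axis (f i) 1"
    by (simp add: vec_eq_iff axis_def)
  let ?B = "(\<lambda>j. axis j 1 :: 'a^'n) ` (f ` K)"
  have B: "axis (f r) 1 \<in> vec.span ?B" if "r \<in> K" for r
    using that by (intro vec.span_base) blast
  have "row r A \<in> vec.span ?B" for r
    unfolding row axis_c using assms(2)
    by (auto intro!: vec.span_add vec.span_scale vec.span_zero B)
  then have 1: "rows A \<subseteq> vec.span ?B" by (auto simp: rows_def)
  have row_in: "row r A \<in> vec.span (rows A)" for r
    by (rule vec.span_base) (auto simp: rows_def)
  have i_in: "axis (f i) 1 \<in> vec.span (rows A)"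
    using row_in[of i] assms(2,3) by (simp add: row)
  have "axis (f r) 1 \<in> vec.span (rows A)" if "r \<in> K" for r
  proof (cases "r = a")
    case True
    have "row r A - c *s axis (f i) 1 \<in> vec.span (rows A)"
      by (intro vec.span_diff row_in vec.span_scale i_in)
    then show ?thesis using True that by (simp add: row axis_c)
  next
    case False
    then show ?thesis using row_in[of r] that by (simp add: row)
  qed
  then have "rank A = card (f ` K)"
    by (intro rank_eq_card_of_rows 1) auto
  then show ?thesis using card_image[of f K] assms(1) by (simp add: A_def inj_on_subset)
qed

lemma rank_matrices_generate:
  fixes H :: "('a::field^'n^'n) set"
  assumes n: "CARD('n) > 1" and k: "1 \<le> k" "k \<le> CARD('n)"
    and H: "additive_subgroup H" "rank_matrices k \<subseteq> H"
  shows "H = UNIV"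
proof -
  have unit: "(\<chi> r. if r = a then axis b c else 0) \<in> H" for a b :: 'n and c :: 'a
  proof -
    have "UNIV \<noteq> {a}" using n by (metis card_1_singleton_iff One_nat_def less_irrefl)
    then obtain i where i: "i \<noteq> a" by blast
    have "card (UNIV - {i}) \<ge> k - 1" using k by (simp add: card_Diff_singleton)
    then obtain K0 where K0: "K0 \<subseteq> UNIV - {i}" "card K0 = k - 1"
      by (meson obtain_subset_with_card_n)
    define K where "K = insert i K0"
    have K: "i \<in> K" "card K = k" using K0 k(1) by (auto simp: K_def card_insert_if)
    \<comment> \<open>The transposition of \<open>i\<close> and \<open>b\<close> moves the unit
      vector of row \<open>i\<close> to column \<open>b\<close>, where the entry \<open>c\<close> is
      wanted.\<close>
    define f where "f = id(i := b, b := i)"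
    have f: "inj f" "f i = b" by (auto simp: f_def inj_def)
    define M :: "'a \<Rightarrow> 'a^'n^'n" where
      "M c = (\<chi> r. (if r \<in> K then axis (f r) 1 else 0) + (if r = a then axis (f i) c else 0))" for c
    have "M c \<in> H" for c
      using H(2) rank_partial_permutation_transvection[OF f(1) K(1) i, of c] K(2)
      by (auto simp: M_def rank_matrices_def)
    \<comment> \<open>Both matrices have rank \<open>k\<close>; the permutation part cancels and
      only the entry \<open>c\<close> at position \<open>(a, b)\<close> survives.\<close>
    then have "M c - M 0 \<in> H" by (intro additive_subgroupD(2)[OF H(1)])
    moreover have "M c - M 0 = (\<chi> r. if r = a then axis b c else 0)"
      by (simp add: M_def vec_eq_iff f axis_def)
    ultimately show ?thesis by simp
  qed
  have "A \<in> H" for A :: "'a^'n^'n"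
  proof -
    have "A = (\<Sum>a\<in>UNIV. \<Sum>b\<in>UNIV. (\<chi> r. if r = a then axis b (A $ a $ b) else 0))"
    proof -
      have "(\<Sum>b\<in>UNIV. (if i = a then axis b (A $ a $ b) else 0) $ j) = (if i = a then A $ a $ j else 0)"
        for i a j by (simp add: axis_def)
      then show ?thesis by (simp add: vec_eq_iff)
    qed
    also have "\<dots> \<in> H" by (intro additive_subgroup_sum[OF H(1)] unit)
    finally show ?thesis .
  qed
  then show ?thesis by blast
qed

theorem theorem3p16:
  fixes S :: "('a::{field,finite}^'n^'n) set" and k :: "nat \<Rightarrow> nat" and r :: nat
  assumes "CARD('n) > 1"
    and "1 \<le> r" and "r \<le> CARD('n) - 1"
    and "strict_mono_on {1..r} k"
    and "\<And>i. i \<in> {1..r} \<Longrightarrow> 1 \<le> k i \<and> k i \<le> CARD('n)"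
    and "S = (\<Union>i\<in>{1..r}. rank_matrices (k i))"
  shows "hamiltonian (matrix_graph S)"
proof -
  let ?T = "rank_matrices (k 1) :: ('a^'n^'n) set"
  have k: "1 \<le> k 1" "k 1 \<le> CARD('n)" using assms(2) assms(5)[of 1] by auto
  have "prime CHAR('a)" by (intro prime_CHAR_semidom finite_imp_CHAR_pos) simp
  moreover have "of_nat CHAR('a) = (0 :: 'a^'n^'n)"
    by (simp add: vec_eq_iff of_nat_index)
  ultimately obtain xs where xs: "distinct xs" "set xs = (UNIV :: ('a^'n^'n) set)"
      "successively (\<lambda>x y. x - y \<in> ?T) xs" "last xs - hd xs \<in> ?T"
    using cayley_hamiltonian_cycle[of "CHAR('a)" ?T] rank_matrices_generate[OF assms(1) k] by metis
  have sub: "?T \<subseteq> S" using assms(2,6) by auto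
  \<comment> \<open>A cycle needs three vertices; there are at least \<open>2 ^ 2\<close> matrices
    because the field has two elements and \<open>n > 1\<close>.\<close>
  have "2 \<le> CARD('a)"
    using card_mono[of UNIV "{0, 1::'a}"] by simp
  then have "2 ^ 2 \<le> CARD('a) ^ 2" by (intro power_mono) auto
  also have "\<dots> \<le> CARD('a) ^ CARD('n)"
    using assms(1) \<open>2 \<le> CARD('a)\<close> by (intro power_increasing) auto
  also have "\<dots> \<le> CARD('a^'n^'n)"
    using self_le_power[of "CARD('a) ^ CARD('n)" "CARD('n)"] by simp
  finally have "3 \<le> length xs"
    using xs(1,2) distinct_card[of xs] by simp
  with xs sub show ?thesis
    by (intro hamiltonian_matrix_graphI[of xs]) (auto intro: successively_mono)
qed

end
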